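(* Let $p \ge 1$ be a number of predicate symbols and $m \ge 1$ a number of metarules in $\mathcal{M}^{i}_{j}$. Let $n$ be the minimum number of clauses needed to express a target theory with standard MIL (using the $p$ predicate symbols and the $m$ metarules). Let $n-k$ be the minimum number of clauses needed to express the target theory with Playgol, i.e. with the same $m$ metarules and the $p$ predicate symbols together with an additional $c$ predicate symbols (so $c \ge 0$ and $0 \le k \le n$). Let $\epsilon,\delta\in(0,1)$, and let $s$ and $s'$ be the sample complexity bounds on the number of training examples required to achieve error less than $\epsilon$ with probability at least $1-\delta$ with standard MIL and with Playgol respectively, that is, \[ s = \frac{1}{\epsilon}\left(n\ln(m) + (j+1)\,n\ln(p) + \ln\frac{1}{\delta}\right), \] \[ s' = \frac{1}{\epsilon}\left((n-k)\ln(m) + (j+1)(n-k)\ln(p+c) + \ln\frac{1}{\delta}\right). \] Then $s > s'$ whenever \[ n\ln(p) > (n-k)\ln(p+c). \]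
   Context: A metarule is a second-order clause template (for example $P(A,B) \leftarrow Q(A,C), R(C,B)$, where $P,Q,R$ are second-order variables to be instantiated by predicate symbols and $A,B,C$ are first-order variables). A metarule is in $\mathcal{M}^{i}_{j}$ if it has at most $j$ literals in the body and each literal has arity at most $i$; here $i,j$ are natural numbers. Meta-interpretive learning (MIL) learns logic programs whose clauses are instances of the given metarules, obtained by substituting available predicate symbols for the second-order variables. Given $p$ predicate symbols and $m$ metarules in $\mathcal{M}^{i}_{j}$, the number of programs expressible with $n$ clauses is taken to be $(mp^{j+1})^n$. Correspondingly, the MIL sample complexity bound with $p$ predicate symbols, $m$ metarules in $\mathcal{M}^{i}_{j}$, clause bound $n$, error $\epsilon$ and confidence parameter $\delta$ is the real number $\frac{1}{\epsilon}\left(n\ln(m) + (j+1)n\ln(p) + \ln\frac{1}{\delta}\right)$ (the number of training examples should be at least this quantity). Playgol is MIL in which the learner first creates and solves its own tasks ("play" stage) and adds the solutions as $c$ additional predicate symbols to the background knowledge, all original predicate symbols remaining available. Thus its bound is the MIL bound with $p$ replaced by $p+c$ and $n$ replaced by $n-k$. Since the original symbols remain available, the minimum number of clauses cannot increase, so $k \ge 0$. *)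

theory Defs
  imports Complex_Main
begin

text \<open>
  One clause type serves three purposes: metarules have second-order and first-order variables
  for \<open>'p\<close> and \<open>'t\<close>, clauses of learned programs have predicate symbols and first-order variables,
  and ground clauses have predicate symbols and elements of the Herbrand universe.
\<close>

datatype (preds_atom: 'p, terms_atom: 't) atom = Atom (pred: 'p) (args: "'t list")

datatype (preds: 'p, terms: 't) clause =
  Clause (head: "('p, 't) atom") (body: "('p, 't) atom list")

type_synonym ('s, 'x) metarule = "('s, 'x) clause"

text \<open>The class usually written \<open>M\<close> with upper index \<open>i\<close> (arity) and lower index \<open>j\<close> (body length).\<close>

definition metarule_class :: "nat \<Rightarrow> nat \<Rightarrow> ('s, 'x) metarule set" where
  "metarule_class i j =
     {M. length (body M) \<le> j \<and> (\<forall>l \<in> insert (head M) (set (body M)). length (args l) \<le> i)}"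

definition metarule_instances :: "('s, 'x) metarule set \<Rightarrow> 'p set \<Rightarrow> ('p, 'x) clause set" where
  "metarule_instances Ms P = {map_clause \<sigma> id M |\<sigma> M. M \<in> Ms \<and> \<sigma> ` preds M \<subseteq> P}"

definition mil_programs :: "('s, 'x) metarule set \<Rightarrow> 'p set \<Rightarrow> ('p, 'x) clause set set" where
  "mil_programs Ms P = {H. finite H \<and> H \<subseteq> metarule_instances Ms P}"

definition ground_instances :: "('p, 'x) clause set \<Rightarrow> ('p, 'u) clause set" where
  "ground_instances H = {map_clause id \<theta> D |\<theta> D. D \<in> H}"

inductive_set least_model :: "('p, 'u) clause set \<Rightarrow> ('p, 'u) atom set"
  for R :: "('p, 'u) clause set" where
  "D \<in> R \<Longrightarrow> (\<And>b. b \<in> set (body D) \<Longrightarrow> b \<in> least_model R) \<Longrightarrow> head D \<in> least_model R"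

text \<open>
  The background knowledge \<open>B\<close> and the target theory \<open>T\<close> are definite programs, represented by
  their ground instances; \<open>T\<close> is self-contained, and only its meaning on the target predicates
  \<open>G\<close> matters, so that a program may use auxiliary predicates.
\<close>

definition expresses ::
  "('p, 'u) clause set \<Rightarrow> 'p set \<Rightarrow> ('p, 'u) clause set \<Rightarrow> ('p, 'x) clause set \<Rightarrow> bool" where
  "expresses B G T H \<longleftrightarrow>
     (\<forall>a. pred a \<in> G \<longrightarrow> (a \<in> least_model (B \<union> ground_instances H) \<longleftrightarrow> a \<in> least_model T))"

definition min_clauses ::
  "('s, 'x) metarule set \<Rightarrow> 'p set \<Rightarrow> ('p, 'u) clause set \<Rightarrow> 'p set \<Rightarrow> ('p, 'u) clause set
    \<Rightarrow> nat \<Rightarrow> bool" where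
  "min_clauses Ms P B G T n \<longleftrightarrow>
     (\<exists>H \<in> mil_programs Ms P. expresses B G T H \<and> card H = n) \<and>
     (\<forall>H \<in> mil_programs Ms P. expresses B G T H \<longrightarrow> n \<le> card H)"

text \<open>
  The play stage yields a program \<open>S\<close> (again given by its ground instances) defining new predicate
  symbols \<open>C\<close>.  The new symbols are fresh, while \<open>S\<close> may call any predicates, including those in \<open>C\<close>.
\<close>

definition play_solutions ::
  "'p set \<Rightarrow> ('p, 'u) clause set \<Rightarrow> 'p set \<Rightarrow> 'p set \<Rightarrow> ('p, 'u) clause set \<Rightarrow> bool" where
  "play_solutions P B G C S \<longleftrightarrow>
     finite C \<and> C \<inter> (P \<union> G \<union> (\<Union>D\<in>B. preds D)) = {} \<and> (\<forall>D\<in>S. pred (head D) \<in> C)"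

definition playgol_min_clauses ::
  "('s, 'x) metarule set \<Rightarrow> 'p set \<Rightarrow> ('p, 'u) clause set \<Rightarrow> 'p set \<Rightarrow> ('p, 'u) clause set
    \<Rightarrow> 'p set \<Rightarrow> ('p, 'u) clause set \<Rightarrow> nat \<Rightarrow> bool" where
  "playgol_min_clauses Ms P B G T C S n \<longleftrightarrow> min_clauses Ms (P \<union> C) (B \<union> S) G T n"

text \<open>
  With \<open>(m * p ^ (j + 1)) ^ n\<close> hypotheses, this is the realizable-case PAC bound
  \<open>(ln (number of hypotheses) + ln (1 / \<delta>)) / \<epsilon>\<close>.
\<close>

definition mil_sample_bound :: "real \<Rightarrow> real \<Rightarrow> nat \<Rightarrow> nat \<Rightarrow> nat \<Rightarrow> nat \<Rightarrow> real" where
  "mil_sample_bound \<epsilon> \<delta> j m p n =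
     1 / \<epsilon> * (real n * ln (real m) + real (j + 1) * real n * ln (real p) + ln (1 / \<delta>))"

end

theory Submission
  imports Defs
begin

text \<open>
  The solutions found by playing define only fresh symbols, so on all other predicates they leave
  the least model unchanged.  Hence a smallest standard program is still a correct program for
  Playgol, which gives \<open>k \<ge> 0\<close>; then the two logarithmic terms can be compared separately.
\<close>

lemma pred_body_in_preds: "b \<in> set (body D) \<Longrightarrow> pred b \<in> preds D"
  by (cases D; cases b) (auto intro: bexI[where x = b])

lemma least_model_mono:
  assumes "a \<in> least_model R" "R \<subseteq> R'"
  shows "a \<in> least_model R'"
  using assms(1)
proof induction
  case (1 D)
  then have "D \<in> R'" using assms(2) by blast
  then show ?case using "1.IH" by (rule least_model.intros)
qed

text \<open>A derivation of an atom outside \<open>C\<close> cannot end with a clause of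
  \<open>S\<close>, whose head would lie in \<open>C\<close>. So its last clause is in
  \<open>R\<close>, and the body of that clause avoids \<open>C\<close> too: the argument descends
  through the whole derivation.\<close>

lemma least_model_Un_fresh:
  assumes fresh: "\<And>D. D \<in> R \<Longrightarrow> preds D \<inter> C = {}"
    and heads: "\<And>D. D \<in> S \<Longrightarrow> pred (head D) \<in> C"
    and "pred a \<notin> C"
  shows "a \<in> least_model (R \<union> S) \<longleftrightarrow> a \<in> least_model R"
proof
  assume "a \<in> least_model (R \<union> S)"
  then show "a \<in> least_model R"
    using \<open>pred a \<notin> C\<close>
  proof induction
    case (1 D)
    then have "D \<in> R" using heads by auto
    moreover have "b \<in> least_model R" if "b \<in> set (body D)" for b
      \<comment> \<open>As \<open>pred a \<notin> C\<close> is chained into the induction, the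
        induction hypothesis for \<open>b\<close> requires \<open>pred b \<notin> C\<close>;
        freshness of the clause \<open>D\<close> supplies it.\<close>
      using "1.IH"[OF that] fresh[OF \<open>D \<in> R\<close>] pred_body_in_preds[OF that] by blast
    ultimately show ?case by (rule least_model.intros)
  qed
next
  assume "a \<in> least_model R"
  then show "a \<in> least_model (R \<union> S)" by (rule least_model_mono) simp
qed

text \<open>Grounding replaces terms only, so every predicate symbol is still one that the
  metasubstitution took from \<open>P\<close>. This keeps learned clauses clear of the play
  symbols.\<close>

lemma preds_ground_instances:
  assumes "H \<in> mil_programs Ms P" "D \<in> ground_instances H"
  shows "preds D \<subseteq> P"
proof -
  obtain \<theta> D' where D: "D = map_clause id \<theta> D'" "D' \<in> H"
    using assms(2) unfolding ground_instances_def by blast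
  then have "D' \<in> metarule_instances Ms P"
    using assms(1) unfolding mil_programs_def by blast
  then show ?thesis
    unfolding D(1) metarule_instances_def by (auto simp: clause.set_map)
qed

lemma mil_programs_mono: "P \<subseteq> Q \<Longrightarrow> mil_programs Ms P \<subseteq> mil_programs Ms Q"
  unfolding mil_programs_def metarule_instances_def by fast

text \<open>Each part of the freshness of \<open>C\<close> has its use: disjointness from
  \<open>P\<close> covers the clauses of \<open>H\<close>, from the symbols of \<open>B\<close> the
  background clauses, and from \<open>G\<close> the atoms on which meanings are compared.\<close>

lemma expresses_play_solutions:
  assumes play: "play_solutions P B G C S" and H: "H \<in> mil_programs Ms P"
  shows "expresses (B \<union> S) G T H \<longleftrightarrow> expresses B G T H"
proof -
  have "a \<in> least_model (B \<union> S \<union> ground_instances H) \<longleftrightarrow>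
      a \<in> least_model (B \<union> ground_instances H)" if "pred a \<in> G" for a
  proof -
    have "preds D \<inter> C = {}" if "D \<in> B \<union> ground_instances H" for D
      using that play preds_ground_instances[OF H] unfolding play_solutions_def by blast
    moreover have "pred (head D) \<in> C" if "D \<in> S" for D
      using that play unfolding play_solutions_def by blast
    moreover have "pred a \<notin> C"
      using that play unfolding play_solutions_def by blast
    ultimately have "a \<in> least_model ((B \<union> ground_instances H) \<union> S) \<longleftrightarrow>
        a \<in> least_model (B \<union> ground_instances H)"
      by (rule least_model_Un_fresh)
    then show ?thesis by (simp add: Un_ac)
  qed
  then show ?thesis unfolding expresses_def by blast
qed

text \<open>A minimal standard program, which simply ignores the new symbols, is a competitor in the
  minimum for Playgol.\<close>

lemma playgol_min_clauses_le:
  assumes play: "play_solutions P B G C S"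
    and "min_clauses Ms P B G T n" and "playgol_min_clauses Ms P B G T C S n'"
  shows "n' \<le> n"
proof -
  obtain H where H: "H \<in> mil_programs Ms P" "expresses B G T H" "card H = n"
    using assms(2) unfolding min_clauses_def by blast
  moreover have "H \<in> mil_programs Ms (P \<union> C)"
    using H(1) mil_programs_mono[of P "P \<union> C"] by blast
  ultimately show ?thesis
    using assms(3) expresses_play_solutions[OF play H(1)]
    unfolding playgol_min_clauses_def min_clauses_def by blast
qed

text \<open>Since \<open>m \<ge> 1\<close> makes \<open>ln (real m)\<close> nonnegative, the
  metarule term cannot grow when the clause count drops; the strict gain comes from the predicate
  term alone.\<close>

lemma mil_sample_bound_less:
  assumes "0 < \<epsilon>" "m \<ge> 1" "n' \<le> n"
    and "real n' * ln (real p') < real n * ln (real p)"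
  shows "mil_sample_bound \<epsilon> \<delta> j m p' n' < mil_sample_bound \<epsilon> \<delta> j m p n"
proof -
  have "real n' * ln (real m) \<le> real n * ln (real m)"
    using assms by (intro mult_right_mono) auto
  moreover have "real (j + 1) * (real n' * ln (real p')) < real (j + 1) * (real n * ln (real p))"
    using assms(4) by (intro mult_strict_left_mono) auto
  ultimately show ?thesis
    \<comment> \<open>Reassociation matches the predicate term to the second inequality. The rules
      then strip the positive factor \<open>1 / \<epsilon>\<close> and the common
      \<open>ln (1 / \<delta>)\<close>, leaving a weak and a strict inequality to add.\<close>
    unfolding mil_sample_bound_def mult.assoc using assms(1)
    by (intro mult_strict_left_mono add_strict_right_mono add_le_less_mono) simp_all
qed

theorem theorem1:
  fixes Ms :: "('s, 'x) metarule set"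
    and P C G :: "'p set"
    and B T S :: "('p, 'u) clause set"
    and i j m p c n :: nat and k :: int
    and \<epsilon> \<delta> s s' :: real
  assumes "finite Ms" and "card Ms = m" and "m \<ge> 1" and "Ms \<subseteq> metarule_class i j"
    and "finite P" and "card P = p" and "p \<ge> 1"
    and "play_solutions P B G C S" and "card C = c"
    and "min_clauses Ms P B G T n"
    and "k \<le> int n" and "playgol_min_clauses Ms P B G T C S (nat (int n - k))"
    and "0 < \<epsilon>" and "\<epsilon> < 1" and "0 < \<delta>" and "\<delta> < 1"
    and "s = mil_sample_bound \<epsilon> \<delta> j m p n"
    and "s' = mil_sample_bound \<epsilon> \<delta> j m (p + c) (nat (int n - k))"
    and "real n * ln (real p) > (real n - real_of_int k) * ln (real (p + c))"
  shows "s > s'"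
proof -
  \<comment> \<open>\<open>k\<close> is an integer whose sign is not assumed;
    \<open>k \<le> int n\<close> ensures that \<open>nat\<close> does not truncate, and
    \<open>n' \<le> n\<close> below amounts to \<open>k \<ge> 0\<close>.\<close>
  define n' where "n' = nat (int n - k)"
  have n': "real n' = real n - real_of_int k"
    using \<open>k \<le> int n\<close> unfolding n'_def by simp
  have "n' \<le> n"
    using assms(8,10,12) unfolding n'_def by (rule playgol_min_clauses_le)
  moreover have "real n' * ln (real (p + c)) < real n * ln (real p)"
    using assms(19) unfolding n' .
  ultimately have "mil_sample_bound \<epsilon> \<delta> j m (p + c) n' < mil_sample_bound \<epsilon> \<delta> j m p n"
    by (rule mil_sample_bound_less[OF \<open>0 < \<epsilon>\<close> \<open>m \<ge> 1\<close>])
  then show ?thesis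
    using assms(17,18) unfolding n'_def by simp
qed

end
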